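(* $f_5(3)=\dfrac{1}{\sqrt{5}}$.
   Context: $\Delta(\cdot)$ denotes area in the Euclidean plane. For integers $n,m$ with $3\le m\le n-1$, define $$f_n(m)=\min_{P\in\mathcal{P}_n}\ \max_{Q\subset P,\ |Q|=m}\frac{\Delta(Q)}{\Delta(P)},$$ where $\mathcal{P}_n$ is the class of all convex $n$-gons in the plane and, for each $P$, the maximum is taken over all convex $m$-gons $Q$ contained in $P$ ($|Q|$ denotes the number of vertices of $Q$). *)

theory Defs
  imports "HOL-Analysis.Analysis"
begin

text \<open>For \<open>n \<ge> 3\<close> the extreme points of a convex \<open>n\<close>-gon are automatically not collinear, so
  it has nonempty interior and positive area. The polygon is the closed planar region.\<close>

definition convex_ngon :: "nat \<Rightarrow> (real^2) set \<Rightarrow> bool" where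
  "convex_ngon n P \<longleftrightarrow> polytope P \<and> card {v. v extreme_point_of P} = n"

definition area :: "(real^2) set \<Rightarrow> real" where
  "area P = measure lebesgue P"

definition max_ratio :: "nat \<Rightarrow> (real^2) set \<Rightarrow> real" where
  "max_ratio m P = (GREATEST r. \<exists>Q. convex_ngon m Q \<and> Q \<subseteq> P \<and> r = area Q / area P)"

text \<open>Both extrema are attained ones: \<open>GREATEST\<close> and \<open>LEAST\<close> on the reals are unspecified when
  no greatest or least element exists, unlike \<open>Sup\<close> and \<open>Inf\<close>. Hence an equation for \<open>f_ngon n m\<close>
  includes the existence of a minimizing polygon. The function is meaningful for
  \<open>3 \<le> m \<le> n - 1\<close>.\<close>

definition f_ngon :: "nat \<Rightarrow> nat \<Rightarrow> real" where
  "f_ngon n m = (LEAST r. \<exists>P. convex_ngon n P \<and> r = max_ratio m P)"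

end

theory Submission
  imports Defs
begin

text \<open>
  A largest triangle in a pentagon can be taken to have its corners at vertices, because its area
  is a convex function of each corner (\<open>orient_hull_bound\<close>). So the claim concerns the ten
  triangles spanned by five points. Let \<open>S\<close> be the area of the pentagon. Five of the triangles
  are its ears, cut off by three consecutive vertices, with areas \<open>x\<^sub>0, \<dots>, x\<^sub>4\<close> in cyclic order;
  each of the other five is what remains after the removal of two ears that have only one
  vertex in common, so it has area \<open>S - x\<^sub>i - x\<^sub>i\<^sub>+\<^sub>2\<close>. A theorem of Gauss relates the ears to the
  whole (\<open>pentagon_area_quadratic\<close>):
  \<open>S\<^sup>2 - S (x\<^sub>0 + \<dots> + x\<^sub>4) + (x\<^sub>0 x\<^sub>1 + x\<^sub>1 x\<^sub>2 + \<dots> + x\<^sub>4 x\<^sub>0) = 0\<close>.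

  For the regular pentagon all ears are \<open>r S\<close>, where \<open>r\<close> is a root of \<open>1 - 5 r + 5 r\<^sup>2\<close> with
  \<open>1 - 2 r = 1 / sqrt 5\<close>. Suppose that all ten triangles had area at most \<open>T < S / sqrt 5\<close>, and
  write \<open>x\<^sub>i = r S + y\<^sub>i\<close>. The inner triangles give \<open>y\<^sub>i + y\<^sub>i\<^sub>+\<^sub>2 > 0\<close>, the ears give
  \<open>y\<^sub>i \<le> T - r S\<close>, and Gauss's relation becomes
  \<open>y\<^sub>0 y\<^sub>1 + \<dots> + y\<^sub>4 y\<^sub>0 = (S / sqrt 5) (y\<^sub>0 + \<dots> + y\<^sub>4)\<close>. An elementary inequality
  (\<open>cyclic_product_bound\<close>) bounds the left side by \<open>(T - r S) (y\<^sub>0 + \<dots> + y\<^sub>4)\<close>, although single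
  \<open>y\<^sub>i\<close> may be negative. The last sum is positive, hence \<open>S / sqrt 5 \<le> T - r S < T\<close>, a
  contradiction (\<open>area_le_sqrt5_max\<close>).

  Geometrically it remains to put the vertices of a convex pentagon into cyclic order, by sorting
  them by their direction as seen from one of them (\<open>convex_pentagonE\<close>), and to compute the area
  by the fan of triangles from that vertex (\<open>ccw_pentagon_area\<close>). The bound is attained by an
  affine image of the regular pentagon (\<open>extremal_pentagon\<close>).
\<close>

section \<open>Orientation determinants and triangles\<close>

text \<open>Twice the signed area of the triangle, positive if its corners run counterclockwise.\<close>

definition orient :: "real^2 \<Rightarrow> real^2 \<Rightarrow> real^2 \<Rightarrow> real" where
  "orient a b c = (b$1 - a$1) * (c$2 - a$2) - (b$2 - a$2) * (c$1 - a$1)"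

lemma orient_rotate: "orient b c a = orient a b c"
  by (simp add: orient_def algebra_simps)

lemma orient_swap: "orient b a c = - orient a b c"
  by (simp add: orient_def algebra_simps)

lemma orient_swap_right: "orient a c b = - orient a b c"
  by (simp add: orient_def algebra_simps)

lemma orient_permutations:
  assumes "orient a b c = k"
  shows "orient b c a = k" "orient c a b = k"
    "orient b a c = - k" "orient a c b = - k" "orient c b a = - k"
  unfolding assms[symmetric] by (simp_all add: orient_def algebra_simps)

lemma orient_same [simp]: "orient a a b = 0" "orient a b a = 0" "orient a b b = 0"
  by (simp_all add: orient_def algebra_simps)

lemma orient_affine:
  "u + v = 1 \<Longrightarrow> orient a b (u *\<^sub>R x + v *\<^sub>R y) = u * orient a b x + v * orient a b y"
proof -
  assume "u + v = 1"
  then have v: "v = 1 - u" by simp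
  show ?thesis by (simp add: v orient_def) algebra
qed

lemma convex_orient_ge: "convex {p. k \<le> orient a b p}"
proof (rule convexI)
  fix x y u v assume "x \<in> {p. k \<le> orient a b p}" "y \<in> {p. k \<le> orient a b p}"
    and uv: "0 \<le> u" "0 \<le> v" "u + v = (1::real)"
  then have "u * k + v * k \<le> u * orient a b x + v * orient a b y"
    by (intro add_mono mult_left_mono) auto
  moreover have "u * k + v * k = k" using uv by (metis distrib_right mult_1)
  ultimately show "u *\<^sub>R x + v *\<^sub>R y \<in> {p. k \<le> orient a b p}"
    using orient_affine[OF uv(3)] by simp
qed

lemma orient_hull_ge:
  assumes "p \<in> convex hull V" "\<And>v. v \<in> V \<Longrightarrow> k \<le> orient a b v"
  shows "k \<le> orient a b p"
  using hull_minimal[of V "{p. k \<le> orient a b p}" convex] convex_orient_ge assms by blast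

lemma orient_hull_le:
  assumes "p \<in> convex hull V" "\<And>v. v \<in> V \<Longrightarrow> orient a b v \<le> k"
  shows "orient a b p \<le> k"
  using orient_hull_ge[OF assms(1), of "-k" b a] assms(2) by (simp add: orient_swap[of b a])

text \<open>The three determinants with \<open>p\<close> are, up to the factor \<open>orient a b c\<close>, the barycentric
  coordinates of \<open>p\<close>.\<close>

lemma triangle_memI:
  assumes pos: "0 < orient a b c"
    and edges: "0 \<le> orient a b p" "0 \<le> orient b c p" "0 \<le> orient c a p"
  shows "p \<in> convex hull {a, b, c}"
proof -
  let ?d = "orient a b c"
  have "orient b c p + orient c a p + orient a b p = ?d"
    unfolding orient_def by algebra
  then have sum1: "orient b c p / ?d + orient c a p / ?d + orient a b p / ?d = 1"
    using pos by (simp flip: add_divide_distrib)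
  have "?d * p$1 = orient b c p * a$1 + orient c a p * b$1 + orient a b p * c$1"
       "?d * p$2 = orient b c p * a$2 + orient c a p * b$2 + orient a b p * c$2"
    unfolding orient_def by algebra+
  then have "p = (orient b c p / ?d) *\<^sub>R a + (orient c a p / ?d) *\<^sub>R b + (orient a b p / ?d) *\<^sub>R c"
    using pos by (simp add: vec_eq_iff forall_2 field_simps)
  then show ?thesis
    unfolding convex_hull_3 using sum1 pos edges
    by (intro CollectI exI[of _ "orient b c p / ?d"] exI[of _ "orient c a p / ?d"]
          exI[of _ "orient a b p / ?d"]) auto
qed

lemma area_triangle: "area (convex hull {a, b, c}) = \<bar>orient a b c\<bar> / 2"
proof -
  have m: "convex hull {a, b, c} \<in> sets lborel"
    by (simp add: finite_imp_compact_convex_hull compact_imp_closed)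
  have "area (convex hull {a, b, c}) = measure lborel (convex hull {a, b, c})"
    unfolding area_def using m by (simp add: measure_completion)
  then show ?thesis
    by (simp add: content_triangle orient_def abs_minus_commute mult.commute)
qed

section \<open>Convex polygons and their largest triangles\<close>

lemma convex_ngon_hull:
  assumes "finite V" "card V = n" "\<And>v. v \<in> V \<Longrightarrow> v \<notin> convex hull (V - {v})"
  shows "convex_ngon n (convex hull V)"
proof -
  have "{v. v extreme_point_of convex hull V} = V"
    using extreme_point_of_convex_hull_convex_independent[of V] assms
    by (auto simp: finite_imp_compact)
  then show ?thesis
    using assms by (simp add: convex_ngon_def polytope_convex_hull)
qed

lemma convex_ngonE:
  assumes "convex_ngon n P"
  obtains V where "card V = n" "P = convex hull V" "finite V"
    "\<And>v. v \<in> V \<Longrightarrow> v \<notin> convex hull (V - {v})"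
proof
  let ?V = "{v. v extreme_point_of P}"
  show "card ?V = n" using assms by (simp add: convex_ngon_def)
  show "finite ?V"
    using assms finite_polyhedron_extreme_points polytope_imp_polyhedron
    unfolding convex_ngon_def by blast
  show P: "P = convex hull ?V"
    using assms Krein_Milman_Minkowski polytope_imp_compact polytope_imp_convex
    unfolding convex_ngon_def by blast
  fix v assume v: "v \<in> ?V"
  show "v \<notin> convex hull (?V - {v})"
  proof
    assume "v \<in> convex hull (?V - {v})"
    then have "convex hull (?V - {v}) = P"
      by (metis P hull_redundant insert_Diff v)
    with v show False
      using extreme_point_of_convex_hull[of v "?V - {v}"] by auto
  qed
qed

text \<open>The line through two of the points separates the third from their segment.\<close>

lemma triangle_convex_ngon:
  assumes "orient a b c \<noteq> 0"
  shows "convex_ngon 3 (convex hull {a, b, c})"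
proof -
  have apex: "x \<notin> convex hull {y, z}" if "orient y z x \<noteq> 0" for x y z
  proof
    assume "x \<in> convex hull {y, z}"
    then have "0 \<le> orient y z x" "orient y z x \<le> 0"
      by (auto elim!: orient_hull_ge orient_hull_le)
    with that show False by simp
  qed
  have ne: "a \<noteq> b" "a \<noteq> c" "b \<noteq> c" using assms by auto
  have "orient b c a \<noteq> 0" "orient c a b \<noteq> 0" using assms orient_rotate by metis+
  moreover have "{a,b,c} - {a} = {b,c}" "{a,b,c} - {b} = {c,a}" "{a,b,c} - {c} = {a,b}"
    using ne by auto
  ultimately have "v \<notin> convex hull ({a,b,c} - {v})" if "v \<in> {a,b,c}" for v
    using that apex assms by (metis insertE singletonD)
  then show ?thesis
    using ne by (intro convex_ngon_hull) simp_all
qed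

text \<open>The determinant is affine in each argument, so the corners can be moved one at a time from
  points of the hull to vertices.\<close>

lemma orient_hull_bound:
  assumes "\<And>x y z. x \<in> V \<Longrightarrow> y \<in> V \<Longrightarrow> z \<in> V \<Longrightarrow> \<bar>orient x y z\<bar> \<le> M"
    and pqr: "p \<in> convex hull V" "q \<in> convex hull V" "r \<in> convex hull V"
  shows "\<bar>orient p q r\<bar> \<le> M"
proof -
  have step: "\<bar>orient x y z\<bar> \<le> M"
    if "z \<in> convex hull V" "\<And>v. v \<in> V \<Longrightarrow> \<bar>orient x y v\<bar> \<le> M" for x y z
    using orient_hull_ge[OF that(1), of "-M" x y] orient_hull_le[OF that(1), of x y M] that(2)
    by (force simp: abs_le_iff)
  have 1: "\<bar>orient x y r\<bar> \<le> M" if "x \<in> V" "y \<in> V" for x y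
    using step assms that by blast
  have 2: "\<bar>orient x q r\<bar> \<le> M" if "x \<in> V" for x
    using step[OF pqr(2), of r x] 1 that orient_rotate by metis
  show ?thesis
    using step[OF pqr(1), of q r] 2 orient_rotate by metis
qed

text \<open>A triple of vertices with the largest determinant realises the greatest element; without
  such a witness nothing would be known about \<open>max_ratio\<close>.\<close>

lemma max_ratio_triangle:
  assumes P: "P = convex hull V"
    and mem: "a \<in> V" "b \<in> V" "c \<in> V" and pos: "0 < orient a b c"
    and max: "\<And>x y z. x \<in> V \<Longrightarrow> y \<in> V \<Longrightarrow> z \<in> V \<Longrightarrow> \<bar>orient x y z\<bar> \<le> orient a b c"
  shows "max_ratio 3 P = orient a b c / 2 / area P"
  unfolding max_ratio_def
proof (rule Greatest_equality)
  have "convex hull {a, b, c} \<subseteq> P"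
    unfolding P by (rule hull_mono) (use mem in simp)
  then show "\<exists>Q. convex_ngon 3 Q \<and> Q \<subseteq> P \<and> orient a b c / 2 / area P = area Q / area P"
    using triangle_convex_ngon[of a b c] pos
    by (intro exI[of _ "convex hull {a, b, c}"]) (simp add: area_triangle)
next
  fix s assume "\<exists>Q. convex_ngon 3 Q \<and> Q \<subseteq> P \<and> s = area Q / area P"
  then obtain Q where Q: "convex_ngon 3 Q" "Q \<subseteq> P" "s = area Q / area P" by auto
  obtain W where W: "card W = 3" "Q = convex hull W" using convex_ngonE[OF Q(1)] by blast
  then obtain x y z where xyz: "W = {x, y, z}" by (auto simp: card_3_iff)
  have "W \<subseteq> convex hull V"
    using hull_subset[of W convex] W(2) Q(2) P by simp
  then have "\<bar>orient x y z\<bar> \<le> orient a b c"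
    unfolding xyz by (intro orient_hull_bound[OF max]) auto
  then have "area Q \<le> orient a b c / 2"
    unfolding W(2) xyz area_triangle by simp
  then show "s \<le> orient a b c / 2 / area P"
    unfolding Q(3) by (intro divide_right_mono) (simp_all add: area_def)
qed

lemma max_triangle_exists:
  assumes "finite V" "V \<noteq> {}"
  obtains x y z where "x \<in> V" "y \<in> V" "z \<in> V"
    "\<And>p q r. p \<in> V \<Longrightarrow> q \<in> V \<Longrightarrow> r \<in> V \<Longrightarrow> \<bar>orient p q r\<bar> \<le> orient x y z"
proof -
  let ?f = "\<lambda>(x, y, z). orient x y z"
  have fin: "finite (V \<times> V \<times> V)" "V \<times> V \<times> V \<noteq> {}" using assms by auto
  have "Max (?f ` (V \<times> V \<times> V)) \<in> ?f ` (V \<times> V \<times> V)"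
    using fin by (intro Max_in) auto
  then obtain m where m: "m \<in> V \<times> V \<times> V" and eq: "?f m = Max (?f ` (V \<times> V \<times> V))"
    by (metis (no_types, lifting) imageE)
  have max: "?f t \<le> ?f m" if "t \<in> V \<times> V \<times> V" for t
    unfolding eq using fin(1) that by (intro Max_ge) auto
  obtain x y z where xyz: "m = (x, y, z)" by (cases m)
  have "\<bar>orient p q r\<bar> \<le> orient x y z" if "p \<in> V" "q \<in> V" "r \<in> V" for p q r
    \<comment> \<open>Exchanging two corners changes the sign, so the largest signed value is also the largest
      absolute value.\<close>
    using max[of "(p, q, r)"] max[of "(q, p, r)"] that xyz orient_swap[of q p r] by auto
  then show thesis using that m xyz by auto
qed

section \<open>The area of a pentagon\<close>

text \<open>Positivity for all ten triples, and not just for consecutive vertices: a pentagram turns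
  left at each of its corners too.\<close>

definition ccw_pentagon :: "real^2 \<Rightarrow> real^2 \<Rightarrow> real^2 \<Rightarrow> real^2 \<Rightarrow> real^2 \<Rightarrow> bool" where
  "ccw_pentagon a b c d e \<longleftrightarrow>
     0 < orient a b c \<and> 0 < orient a b d \<and> 0 < orient a b e \<and> 0 < orient a c d \<and>
     0 < orient a c e \<and> 0 < orient a d e \<and> 0 < orient b c d \<and> 0 < orient b c e \<and>
     0 < orient b d e \<and> 0 < orient c d e"

lemma ccw_pentagon_rotate: "ccw_pentagon a b c d e \<Longrightarrow> ccw_pentagon b c d e a"
  unfolding ccw_pentagon_def using orient_rotate by metis

text \<open>The diagonal between the neighbours of \<open>a\<close> has \<open>a\<close> strictly on one side and all other vertices
  on the other side or on the diagonal itself.\<close>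

lemma ccw_pentagon_vertex:
  assumes "ccw_pentagon a b c d e"
  shows "a \<notin> convex hull {b, c, d, e}"
proof
  assume "a \<in> convex hull {b, c, d, e}"
  moreover have "0 \<le> orient e b v" if "v \<in> {b, c, d, e}" for v
    using that assms orient_rotate[of b c e] orient_rotate[of b d e] by (auto simp: ccw_pentagon_def)
  ultimately have "0 \<le> orient e b a" by (rule orient_hull_ge)
  moreover have "orient e b a = - orient a b e" by (simp add: orient_def algebra_simps)
  ultimately show False using assms by (simp add: ccw_pentagon_def)
qed

lemma ccw_pentagon_card:
  assumes "ccw_pentagon a b c d e"
  shows "card {a, b, c, d, e} = 5"
proof -
  have "distinct [a, b, c, d, e]"
    using assms unfolding ccw_pentagon_def by auto
  then show ?thesis using distinct_card[of "[a, b, c, d, e]"] by simp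
qed

lemma ccw_pentagon_convex_ngon:
  assumes "ccw_pentagon a b c d e"
  shows "convex_ngon 5 (convex hull {a, b, c, d, e})"
proof (rule convex_ngon_hull)
  have rot: "ccw_pentagon b c d e a" "ccw_pentagon c d e a b" "ccw_pentagon d e a b c"
    "ccw_pentagon e a b c d"
    using assms ccw_pentagon_rotate by blast+
  have "{a, b, c, d, e} - {a} \<subseteq> {b, c, d, e}" "{a, b, c, d, e} - {b} \<subseteq> {c, d, e, a}"
    "{a, b, c, d, e} - {c} \<subseteq> {d, e, a, b}" "{a, b, c, d, e} - {d} \<subseteq> {e, a, b, c}"
    "{a, b, c, d, e} - {e} \<subseteq> {a, b, c, d}"
    by auto
  from this[THEN hull_mono, of convex]
  show "v \<notin> convex hull ({a, b, c, d, e} - {v})" if "v \<in> {a, b, c, d, e}" for v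
    using that rot[THEN ccw_pentagon_vertex] ccw_pentagon_vertex[OF assms] by blast
qed (use ccw_pentagon_card[OF assms] in simp_all)

lemma negligible_line:
  assumes "a \<noteq> b"
  shows "negligible {p. orient a b p = 0}"
proof -
  let ?n = "vector [-(b$2 - a$2), b$1 - a$1] :: real^2"
  have "{p. orient a b p = 0} = {p. ?n \<bullet> p = ?n \<bullet> a}"
    by (auto simp: orient_def inner_vec_def sum_2 algebra_simps)
  moreover have "?n \<noteq> 0"
    using assms by (auto simp: vec_eq_iff forall_2)
  ultimately show ?thesis using negligible_hyperplane by metis
qed

text \<open>The diagonals from \<open>a\<close> cut the pentagon into three sectors. A point of the pentagon lies on
  the inner side of each edge, and the signs with respect to the two diagonals tell which triangle
  it belongs to.\<close>

lemma ccw_pentagon_fan: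
  assumes "ccw_pentagon a b c d e"
  shows "convex hull {a, b, c, d, e}
    = convex hull {a, b, c} \<union> convex hull {a, c, d} \<union> convex hull {a, d, e}"
proof
  show "convex hull {a, b, c, d, e}
    \<subseteq> convex hull {a, b, c} \<union> convex hull {a, c, d} \<union> convex hull {a, d, e}"
  proof
    fix p assume p: "p \<in> convex hull {a, b, c, d, e}"
    have edge: "0 \<le> orient x y p" if "ccw_pentagon x y z u w" "{x, y, z, u, w} = {a, b, c, d, e}"
      for x y z u w
    proof (rule orient_hull_ge)
      show "p \<in> convex hull {x, y, z, u, w}" using p that(2) by simp
      show "0 \<le> orient x y v" if "v \<in> {x, y, z, u, w}" for v
        using that \<open>ccw_pentagon x y z u w\<close> unfolding ccw_pentagon_def by auto
    qed
    have rot: "ccw_pentagon b c d e a" "ccw_pentagon c d e a b" "ccw_pentagon d e a b c"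
      "ccw_pentagon e a b c d"
      using assms ccw_pentagon_rotate by blast+
    have e: "0 \<le> orient a b p" "0 \<le> orient b c p" "0 \<le> orient c d p" "0 \<le> orient d e p"
      "0 \<le> orient e a p"
      by (rule edge, rule assms rot, blast)+
    have pos: "0 < orient a b c" "0 < orient a c d" "0 < orient a d e"
      using assms by (auto simp: ccw_pentagon_def)
    consider "0 \<le> orient c a p" | "0 \<le> orient a c p" "0 \<le> orient d a p" | "0 \<le> orient a d p"
      using orient_swap[of c a p] orient_swap[of d a p] by linarith
    then show "p \<in> convex hull {a, b, c} \<union> convex hull {a, c, d} \<union> convex hull {a, d, e}"
      by cases (use triangle_memI[OF pos(1)] triangle_memI[OF pos(2)] triangle_memI[OF pos(3)] e in blast)+
  qed
  show "convex hull {a, b, c} \<union> convex hull {a, c, d} \<union> convex hull {a, d, e}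
    \<subseteq> convex hull {a, b, c, d, e}"
    by (intro Un_least hull_mono) auto
qed

lemma ccw_pentagon_area:
  assumes "ccw_pentagon a b c d e"
  shows "area (convex hull {a, b, c, d, e}) = (orient a b c + orient a c d + orient a d e) / 2"
proof -
  have pos: "0 < orient a b c" "0 < orient a c d" "0 < orient a d e" "0 < orient a b d"
    "0 < orient a c e"
    using assms by (auto simp: ccw_pentagon_def)
  have acb: "orient a c b = - orient a b c" and adb: "orient a d b = - orient a b d"
    and adc: "orient a d c = - orient a c d"
    by (rule orient_swap_right)+
  have left: "orient a c p \<le> 0" "orient a d p \<le> 0" if "p \<in> convex hull {a, b, c}" for p
    by (rule orient_hull_le[OF that]; use pos acb adb adc in auto)+
  have mid: "0 \<le> orient a c p" "orient a d p \<le> 0" if "p \<in> convex hull {a, c, d}" for p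
    by (rule orient_hull_ge[OF that] orient_hull_le[OF that]; use pos adc in auto)+
  have right: "0 \<le> orient a c p" "0 \<le> orient a d p" if "p \<in> convex hull {a, d, e}" for p
    by (rule orient_hull_ge[OF that]; use pos in auto)+
  have ne: "a \<noteq> c" "a \<noteq> d" using pos by auto
  have "negligible (convex hull {a, b, c} \<inter> convex hull {a, c, d})"
    "negligible (convex hull {a, b, c} \<inter> convex hull {a, d, e})"
    by (rule negligible_subset[OF negligible_line[OF ne(1)]]; use left mid right in force)+
  moreover have "negligible (convex hull {a, c, d} \<inter> convex hull {a, d, e})"
    by (rule negligible_subset[OF negligible_line[OF ne(2)]]; use left mid right in force)
  ultimately have "area (convex hull {a, b, c, d, e})
    = area (convex hull {a, b, c}) + area (convex hull {a, c, d}) + area (convex hull {a, d, e})"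
    unfolding area_def
    by (intro measure_Un3_negligible)
      (simp_all add: ccw_pentagon_fan[OF assms] lmeasurable_compact finite_imp_compact_convex_hull)
  then show ?thesis using pos by (simp add: area_triangle)
qed

section \<open>The inequality for the ten triangles\<close>

text \<open>If all \<open>z\<^sub>i\<close> are nonnegative, each product is at most \<open>K\<close> times one of its factors. A
  negative entry has two neighbours that outweigh it, so at most two entries, not adjacent to each
  other, are negative. In each case the difference of the two sides is a sum of products of
  nonnegative quantities.\<close>

lemma cyclic_product_bound:
  fixes z0 z1 z2 z3 z4 K :: real
  assumes nn: "0 \<le> z0 + z1" "0 \<le> z1 + z2" "0 \<le> z2 + z3" "0 \<le> z3 + z4" "0 \<le> z4 + z0"
    and K: "z0 \<le> K" "z1 \<le> K" "z2 \<le> K" "z3 \<le> K" "z4 \<le> K"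
  shows "z0*z2 + z1*z3 + z2*z4 + z3*z0 + z4*z1 \<le> K * (z0 + z1 + z2 + z3 + z4)"
proof -
  have two_neg: "x0*x2 + x1*x3 + x2*x4 + x3*x0 + x4*x1 \<le> K * (x0 + x1 + x2 + x3 + x4)"
    if "x0 < 0" "x2 < 0" "0 \<le> x0 + x1" "0 \<le> x1 + x2" "0 \<le> x2 + x3" "0 \<le> x4 + x0" "x1 \<le> K"
    for x0 x1 x2 x3 x4
  proof -
    have "0 \<le> (x1 + x0) * (x1 + x2)" using that by simp
    moreover have "0 \<le> (K - x1) * (x1 + (x2 + x3) + (x4 + x0))"
      using that by (intro mult_nonneg_nonneg) auto
    moreover have "0 \<le> - x0 * (x2 + x3)" "0 \<le> - x2 * (x4 + x0)"
      using that by (intro mult_nonneg_nonneg; simp)+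
    ultimately show ?thesis by (simp add: algebra_simps)
  qed
  have one_neg: "x0*x2 + x1*x3 + x2*x4 + x3*x0 + x4*x1 \<le> K * (x0 + x1 + x2 + x3 + x4)"
    if "x0 < 0" "0 \<le> x2" "0 \<le> x3" "0 \<le> x0 + x1" "0 \<le> x4 + x0" "x1 \<le> K" "x4 \<le> K"
    for x0 x1 x2 x3 x4
  proof -
    have "0 \<le> (K - x4) * x1" "0 \<le> K * (x0 + x4)" "0 \<le> (K - (x0 + x1)) * x3"
      "0 \<le> (K - (x0 + x4)) * x2"
      using that by (intro mult_nonneg_nonneg; simp)+
    then show ?thesis by (simp add: algebra_simps)
  qed
  have some_neg: "x0*x2 + x1*x3 + x2*x4 + x3*x0 + x4*x1 \<le> K * (x0 + x1 + x2 + x3 + x4)"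
    if "x0 < 0" "0 \<le> x0 + x1" "0 \<le> x1 + x2" "0 \<le> x2 + x3" "0 \<le> x3 + x4" "0 \<le> x4 + x0"
      "x1 \<le> K" "x4 \<le> K"
    for x0 x1 x2 x3 x4
  proof -
    consider "x2 < 0" | "x3 < 0" | "0 \<le> x2" "0 \<le> x3" by linarith
    then show ?thesis
    proof cases
      case 1 then show ?thesis using two_neg[of x0 x2 x1 x3 x4] that by simp
    next
      case 2 then show ?thesis using two_neg[of x0 x3 x4 x2 x1] that by (simp add: algebra_simps)
    next
      case 3 then show ?thesis using one_neg[of x0 x2 x3 x1 x4] that by simp
    qed
  qed
  have no_neg: "z0*z2 + z1*z3 + z2*z4 + z3*z0 + z4*z1 \<le> K * (z0 + z1 + z2 + z3 + z4)"
    if "0 \<le> z0" "0 \<le> z1" "0 \<le> z2" "0 \<le> z3" "0 \<le> z4"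
  proof -
    have "z0*z2 \<le> K*z2" "z1*z3 \<le> K*z3" "z2*z4 \<le> K*z4" "z3*z0 \<le> K*z0" "z4*z1 \<le> K*z1"
      using that K by (intro mult_right_mono; simp)+
    then show ?thesis by (simp add: algebra_simps)
  qed
  consider "z0 < 0" | "z1 < 0" | "z2 < 0" | "z3 < 0" | "z4 < 0"
    | "0 \<le> z0" "0 \<le> z1" "0 \<le> z2" "0 \<le> z3" "0 \<le> z4" by linarith
  then show ?thesis
  proof cases
    case 1 then show ?thesis using some_neg[of z0 z1 z2 z3 z4] nn K by (simp add: algebra_simps)
  next
    case 2 then show ?thesis using some_neg[of z1 z2 z3 z4 z0] nn K by (simp add: algebra_simps)
  next
    case 3 then show ?thesis using some_neg[of z2 z3 z4 z0 z1] nn K by (simp add: algebra_simps)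
  next
    case 4 then show ?thesis using some_neg[of z3 z4 z0 z1 z2] nn K by (simp add: algebra_simps)
  next
    case 5 then show ?thesis using some_neg[of z4 z0 z1 z2 z3] nn K by (simp add: algebra_simps)
  qed (rule no_neg)
qed

text \<open>Gauss's relation between the area of a pentagon and its ears. It is a polynomial identity for
  five arbitrary points. Seen from \<open>a\<close>, all determinants are linear combinations of those of the
  four vectors to the other points, and for these the relation is the Pluecker identity.\<close>

lemma pentagon_area_quadratic:
  fixes a b c d e :: "real^2"
  defines "S \<equiv> orient a b c + orient a c d + orient a d e"
  shows "S^2 - S * (orient e a b + orient a b c + orient b c d + orient c d e + orient d e a)
    + (orient e a b * orient a b c + orient a b c * orient b c d + orient b c d * orient c d e
       + orient c d e * orient d e a + orient d e a * orient e a b) = 0"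
proof -
  have bcd: "orient b c d = orient a b c + orient a c d - orient a b d"
    and cde: "orient c d e = orient a c d + orient a d e - orient a c e"
    and eab: "orient e a b = orient a b e" "orient d e a = orient a d e"
    by (simp_all add: orient_def algebra_simps)
  have plucker: "orient a b c * orient a d e - orient a b d * orient a c e
      + orient a b e * orient a c d = 0"
    unfolding orient_def by algebra
  show ?thesis
    unfolding S_def bcd cde eab using plucker by algebra
qed

text \<open>The contradiction described at the beginning: \<open>r\<close> is the proportion of an ear in the regular
  pentagon, and the \<open>y\<^sub>i\<close> are the deviations of the ears from it.\<close>

lemma area_le_sqrt5_max:
  fixes S T :: real
  assumes quad: "S^2 - S * (x0 + x1 + x2 + x3 + x4) + (x0*x1 + x1*x2 + x2*x3 + x3*x4 + x4*x0) = 0"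
    and ears: "x0 \<le> T" "x1 \<le> T" "x2 \<le> T" "x3 \<le> T" "x4 \<le> T"
    and inner: "S - (x4 + x1) \<le> T" "S - (x0 + x2) \<le> T" "S - (x1 + x3) \<le> T" "S - (x2 + x4) \<le> T"
      "S - (x3 + x0) \<le> T"
    and "0 \<le> S"
  shows "S \<le> sqrt 5 * T"
proof (rule ccontr)
  assume "\<not> S \<le> sqrt 5 * T"
  then have lt: "T < S / sqrt 5" by (simp add: field_simps)
  define r where "r = (5 - sqrt 5) / 10"
  have r: "1 - 2 * r = 1 / sqrt 5" "1 - 5 * r + 5 * r^2 = 0" "0 < r"
    by (simp_all add: r_def field_simps power2_eq_square real_less_lsqrt)
  define y0 y1 y2 y3 y4 where y_def: "y0 = x0 - r * S" "y1 = x1 - r * S" "y2 = x2 - r * S"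
    "y3 = x3 - r * S" "y4 = x4 - r * S"
  have "S - 2 * (r * S) = (1 - 2 * r) * S" by (simp add: algebra_simps)
  then have gap: "S - 2 * (r * S) = S / sqrt 5" using r(1) by simp
  have pos: "0 < y4 + y1" "0 < y1 + y3" "0 < y3 + y0" "0 < y0 + y2" "0 < y2 + y4"
    using inner lt gap unfolding y_def by linarith+
  have "(S / sqrt 5) * (y0 + y1 + y2 + y3 + y4)
      = (1 - 2 * r) * S * (y0 + y1 + y2 + y3 + y4)"
    using r(1) by simp
  also have "\<dots> = y0*y1 + y1*y2 + y2*y3 + y3*y4 + y4*y0"
    using quad r(2) unfolding y_def by algebra
  also have "\<dots> \<le> (T - r * S) * (y0 + y1 + y2 + y3 + y4)"
  proof -
    \<comment> \<open>The sums known to be positive belong to indices that differ by two. In the order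
      \<open>4, 1, 3, 0, 2\<close> these are cyclic neighbours, and the products to be bounded join entries two
      steps apart.\<close>
    have "y4*y3 + y1*y0 + y3*y2 + y0*y4 + y2*y1 \<le> (T - r * S) * (y4 + y1 + y3 + y0 + y2)"
      by (rule cyclic_product_bound) (use pos ears in \<open>auto simp: y_def\<close>)
    then show ?thesis by (simp add: algebra_simps)
  qed
  finally have "(S / sqrt 5) * (y0 + y1 + y2 + y3 + y4) \<le> (T - r * S) * (y0 + y1 + y2 + y3 + y4)" .
  moreover have "0 < y0 + y1 + y2 + y3 + y4" using pos by linarith
  ultimately have "S / sqrt 5 \<le> T - r * S" by (rule mult_right_le_imp_le)
  moreover have "0 \<le> r * S" using r(3) \<open>0 \<le> S\<close> by simp
  ultimately show False using lt by linarith
qed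

section \<open>Cyclic order of the vertices\<close>

lemma collinear_ray:
  fixes a x y u :: "real^2"
  assumes "orient a x y = 0" and pos: "0 < u \<bullet> (x - a)" "0 < u \<bullet> (y - a)"
    and le: "u \<bullet> (y - a) \<le> u \<bullet> (x - a)"
  shows "y \<in> convex hull {a, x}"
proof -
  define t where "t = (u \<bullet> (y - a)) / (u \<bullet> (x - a))"
  have t: "0 \<le> t" "t \<le> 1" using pos le by (simp_all add: t_def)
  have "(u \<bullet> (x - a)) * (y - a)$1 = (u \<bullet> (y - a)) * (x - a)$1"
    "(u \<bullet> (x - a)) * (y - a)$2 = (u \<bullet> (y - a)) * (x - a)$2"
    using assms(1) unfolding orient_def inner_vec_def sum_2 inner_real_def vector_minus_component
    by algebra+
  then have "y - a = t *\<^sub>R (x - a)"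
    unfolding vec_eq_iff forall_2 vector_scaleR_component t_def using pos by (simp add: field_simps)
  then have "y = a + t *\<^sub>R (x - a)" by (simp add: algebra_simps)
  then show ?thesis unfolding convex_hull_2_alt using t by blast
qed

text \<open>If the turn at \<open>y\<close> were not to the left, \<open>y\<close> would lie in the triangle of its neighbours
  and \<open>a\<close>.\<close>

lemma orient_pos_of_fan:
  assumes "0 < orient a x y" "0 < orient a y z" "0 < orient a x z"
    and "y \<notin> convex hull {a, x, z}"
  shows "0 < orient x y z"
proof (rule ccontr)
  assume "\<not> 0 < orient x y z"
  moreover have "orient x z y = - orient x y z" "orient z a y = orient a y z"
    by (simp_all add: orient_def algebra_simps)
  ultimately have "y \<in> convex hull {a, x, z}"
    using assms by (intro triangle_memI) simp_all
  with assms show False by simp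
qed

text \<open>A line through one vertex \<open>a\<close> leaves all the others strictly on one side, so directions from
  \<open>a\<close> are linearly ordered by their slope. Sorting by slope makes the determinants with first
  argument \<open>a\<close> positive, and extremality of the vertices gives the other four.\<close>

lemma convex_pentagonE:
  assumes "convex_ngon 5 P"
  obtains a b c d e where "ccw_pentagon a b c d e" "P = convex hull {a, b, c, d, e}"
proof -
  obtain V where V: "card V = 5" "P = convex hull V" "finite V"
    and ext: "\<And>v. v \<in> V \<Longrightarrow> v \<notin> convex hull (V - {v})"
    using convex_ngonE[OF assms] by blast
  obtain a where a: "a \<in> V" using V(1) by fastforce
  define W where "W = V - {a}"
  have W: "finite W" "card W = 4" "V = insert a W" "a \<notin> W"
    using V a by (auto simp: W_def)
  have "closed (convex hull W)"
    using W(1) by (simp add: finite_imp_compact_convex_hull compact_imp_closed)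
  then obtain u k where "u \<bullet> a < k" "\<And>x. x \<in> convex hull W \<Longrightarrow> k < u \<bullet> x"
    using separating_hyperplane_closed_point[of "convex hull W" a] ext[OF a] W_def by auto
  then have above: "0 < u \<bullet> (x - a)" if "x \<in> W" for x
    using that hull_inc[of x W convex] by (fastforce simp: inner_diff_right)
  \<comment> \<open>The tangent of the angle between \<open>u\<close> and \<open>x - a\<close>.\<close>
  define slope where "slope x = orient a (a + u) x / (u \<bullet> (x - a))" for x
  have cross: "orient a (a + u) y * (u \<bullet> (x - a)) - orient a (a + u) x * (u \<bullet> (y - a))
      = (u \<bullet> u) * orient a x y" for x y
    unfolding orient_def inner_vec_def sum_2 inner_real_def vector_minus_component
      vector_add_component by algebra
  have slope_less: "0 < orient a x y" if "x \<in> W" "y \<in> W" "slope x < slope y" for x y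
  proof -
    have "0 < (u \<bullet> u) * orient a x y"
      using that(3) above[OF that(1)] above[OF that(2)] cross[of y x]
      by (simp add: slope_def field_simps)
    then show ?thesis
      by (metis inner_ge_zero less_le_not_le mult_nonneg_nonpos not_le)
  qed
  have "inj_on slope W"
  proof (rule inj_onI, rule ccontr)
    fix x y assume xy: "x \<in> W" "y \<in> W" "slope x = slope y" "x \<noteq> y"
    have "u \<noteq> 0" using above[OF xy(1)] by auto
    then have "orient a x y = 0"
      using xy(3) above[OF xy(1)] above[OF xy(2)] cross[of y x]
      by (simp add: slope_def field_simps)
    then have o: "orient a x y = 0" "orient a y x = 0"
      using orient_swap_right[of a x y] by simp_all
    have "y \<in> convex hull {a, x} \<or> x \<in> convex hull {a, y}"
      using collinear_ray[OF o(1)] collinear_ray[OF o(2)] above[OF xy(1)] above[OF xy(2)]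
      by (meson linear)
    moreover have "{a, x} \<subseteq> V - {y}" "{a, y} \<subseteq> V - {x}"
      using xy W(3,4) by auto
    ultimately show False
      using ext[of x] ext[of y] xy W(3) hull_mono[of "{a, x}" "V - {y}" convex]
        hull_mono[of "{a, y}" "V - {x}" convex] by blast
  qed
  define ks where "ks = sorted_list_of_set (slope ` W)"
  have "length ks = 4" "sorted_wrt (<) ks" and ks: "set ks = slope ` W"
    using W card_image[OF \<open>inj_on slope W\<close>] by (simp_all add: ks_def)
  then obtain k1 k2 k3 k4 where "ks = [k1, k2, k3, k4]"
    by (auto simp: numeral_eq_Suc length_Suc_conv)
  then have less: "k1 < k2" "k2 < k3" "k3 < k4" and "slope ` W = {k1, k2, k3, k4}"
    using \<open>sorted_wrt (<) ks\<close> ks by auto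
  then obtain b c d e where bcde: "b \<in> W" "c \<in> W" "d \<in> W" "e \<in> W"
    and k: "k1 = slope b" "k2 = slope c" "k3 = slope d" "k4 = slope e"
    by (smt (verit) imageE insertI1 insertI2)
  have fan: "0 < orient a b c" "0 < orient a b d" "0 < orient a b e" "0 < orient a c d"
    "0 < orient a c e" "0 < orient a d e"
    using less bcde by (auto simp: k intro!: slope_less)
  have dist: "distinct [a, b, c, d, e]"
    using less bcde W(4) by (auto simp: k)
  then have Veq: "V = {a, b, c, d, e}"
    using V bcde a W_def distinct_card[OF dist]
    by (intro card_subset_eq[symmetric]) auto
  have out: "y \<notin> convex hull {a, x, z}" if "{a, x, z} \<subseteq> V - {y}" "y \<in> V" for x y z
    using ext[OF that(2)] hull_mono[OF that(1), of convex] by blast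
  have "0 < orient b c d" "0 < orient b c e" "0 < orient b d e" "0 < orient c d e"
    by (rule orient_pos_of_fan; use fan out dist Veq in auto)+
  then have "ccw_pentagon a b c d e" using fan by (simp add: ccw_pentagon_def)
  then show thesis using that V(2) Veq by blast
qed

section \<open>The bound and a pentagon attaining it\<close>

lemma max_ratio_pentagon_ge:
  assumes "convex_ngon 5 P"
  shows "1 / sqrt 5 \<le> max_ratio 3 P"
proof -
  obtain a b c d e where ccw: "ccw_pentagon a b c d e" and P: "P = convex hull {a, b, c, d, e}"
    using convex_pentagonE[OF assms] .
  obtain x y z where xyz: "x \<in> {a, b, c, d, e}" "y \<in> {a, b, c, d, e}" "z \<in> {a, b, c, d, e}"
    and max: "\<And>p q r. p \<in> {a, b, c, d, e} \<Longrightarrow> q \<in> {a, b, c, d, e} \<Longrightarrow> r \<in> {a, b, c, d, e}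
      \<Longrightarrow> \<bar>orient p q r\<bar> \<le> orient x y z"
    using max_triangle_exists[of "{a, b, c, d, e}"] by auto
  let ?S = "orient a b c + orient a c d + orient a d e"
  have le: "orient p q r \<le> orient x y z"
    if "p \<in> {a, b, c, d, e}" "q \<in> {a, b, c, d, e}" "r \<in> {a, b, c, d, e}" for p q r
    using max[OF that] by linarith
  have pos: "0 < orient a b c" "0 < ?S"
    using ccw by (auto simp: ccw_pentagon_def)
  have inner: "?S - (orient d e a + orient a b c) = orient a c d"
    "?S - (orient e a b + orient b c d) = orient b d e"
    "?S - (orient a b c + orient c d e) = orient a c e"
    "?S - (orient b c d + orient d e a) = orient a b d"
    "?S - (orient c d e + orient e a b) = orient b c e"
    by (simp_all add: orient_def algebra_simps)
  have "?S \<le> sqrt 5 * orient x y z"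
    by (rule area_le_sqrt5_max[OF pentagon_area_quadratic], unfold inner)
      (use pos in \<open>auto intro: le\<close>)
  then have "1 / sqrt 5 \<le> orient x y z / ?S"
    using pos by (simp add: field_simps)
  moreover have "0 < orient x y z" using le[of a b c] pos by simp
  then have "max_ratio 3 P = orient x y z / 2 / area P"
    by (intro max_ratio_triangle[OF P xyz _ max]) simp_all
  moreover have "area P = ?S / 2" using ccw_pentagon_area[OF ccw] P by simp
  ultimately show ?thesis by simp
qed

text \<open>Areas are compared only by their ratios, so any affine image of the regular pentagon serves.
  Consecutive vertices of the regular pentagon centred at the origin satisfy
  \<open>v\<^sub>k\<^sub>+\<^sub>1 = g v\<^sub>k - v\<^sub>k\<^sub>-\<^sub>1\<close> with \<open>g = 2 cos 72\<degree> = (sqrt 5 - 1) / 2\<close>. In the basis \<open>v\<^sub>0, v\<^sub>1\<close> all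
  coordinates are polynomials in \<open>g\<close>, where \<open>g\<^sup>2 = 1 - g\<close>. Every ear then has determinant \<open>2 - g\<close>,
  every other triangle \<open>1 + 2 g = sqrt 5\<close>, and the pentagon \<open>5\<close>.\<close>

lemma extremal_pentagon:
  obtains P where "convex_ngon 5 P" "max_ratio 3 P = 1 / sqrt 5"
proof -
  define g :: real where "g = (sqrt 5 - 1) / 2"
  have g2: "g * g = 1 - g" "g * (g * 2) = 2 - 2 * g" by (simp_all add: g_def field_simps)
  have "2 < sqrt (5::real)" "sqrt (5::real) < 3"
    by (rule real_less_rsqrt, simp) (rule real_less_lsqrt, simp_all)
  then have g: "1 / 2 < g" "g < 1" by (simp_all add: g_def)
  define a b c d e where v_def: "a = (vector [1, 0] :: real^2)" "b = (vector [0, 1] :: real^2)"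
    "c = (vector [-1, g] :: real^2)" "d = (vector [-g, -g] :: real^2)"
    "e = (vector [g, -1] :: real^2)"
  let ?V = "{a, b, c, d, e}"
  have ears: "orient a b c = 2 - g" "orient b c d = 2 - g" "orient c d e = 2 - g"
    "orient a d e = 2 - g" "orient a b e = 2 - g"
    and inner: "orient a b d = 1 + 2 * g" "orient a c d = 1 + 2 * g" "orient a c e = 1 + 2 * g"
      "orient b c e = 1 + 2 * g" "orient b d e = 1 + 2 * g"
    by (simp_all add: orient_def v_def algebra_simps g2)
  then have ccw: "ccw_pentagon a b c d e"
    using g by (simp add: ccw_pentagon_def)
  have sqrt5: "1 + 2 * g = sqrt 5" by (simp add: g_def field_simps)
  have max: "\<bar>orient p q r\<bar> \<le> orient a c d" if "p \<in> ?V" "q \<in> ?V" "r \<in> ?V" for p q r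
  proof -
    note ten = ears inner
    note all_values = ten ten[THEN orient_permutations(1)] ten[THEN orient_permutations(2)]
      ten[THEN orient_permutations(3)] ten[THEN orient_permutations(4)]
      ten[THEN orient_permutations(5)]
    have "\<bar>2 - g\<bar> \<le> 1 + 2 * g" "\<bar>g - 2\<bar> \<le> 1 + 2 * g" "\<bar>1 + 2 * g\<bar> \<le> 1 + 2 * g"
      "\<bar>- 1 - 2 * g\<bar> \<le> 1 + 2 * g" "0 \<le> 1 + 2 * g"
      using g by simp_all
    then show ?thesis
      using that by (elim insertE emptyE; simp add: all_values)
  qed
  have "max_ratio 3 (convex hull ?V) = orient a c d / 2 / area (convex hull ?V)"
    using ccw by (intro max_ratio_triangle[OF refl _ _ _ _ max]) (auto simp: ccw_pentagon_def)
  also have "\<dots> = sqrt 5 / 5"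
    by (simp add: ccw_pentagon_area[OF ccw] ears inner sqrt5[symmetric])
  also have "\<dots> = 1 / sqrt 5" by (simp add: field_simps)
  finally show thesis using that ccw_pentagon_convex_ngon[OF ccw] by blast
qed

theorem theorem2p2:
  "f_ngon 5 3 = 1 / sqrt 5"
  unfolding f_ngon_def
proof (rule Least_equality)
  show "\<exists>P. convex_ngon 5 P \<and> 1 / sqrt 5 = max_ratio 3 P"
    using extremal_pentagon by metis
  show "1 / sqrt 5 \<le> r" if "\<exists>P. convex_ngon 5 P \<and> r = max_ratio 3 P" for r
    using that max_ratio_pentagon_ge by blast
qed

end
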